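(* Let $m\geq 1$ and let $k_1,\ldots,k_m\in\mathbb{Z}$ be arbitrary integers. Then there exist nonnegative integers $n$ and $t$ such that for all $1\leq \ell\leq m$, \[k_\ell=s_2(n+\ell t)-s_2(n).\]
   Context: For a nonnegative integer $n$ with binary expansion $n=\varepsilon_\nu 2^\nu+\cdots+\varepsilon_0 2^0$ ($\varepsilon_i\in\{0,1\}$), the binary sum-of-digits function is $s_2(n)=\varepsilon_\nu+\cdots+\varepsilon_0$, i.e. the number of nonzero binary digits of $n$. *)

theory Defs
  imports Main
begin

definition s2 :: "nat \<Rightarrow> nat" where
  "s2 n = card {i. bit n i}"

lemma finite_bit_nat: "finite {i. bit (n::nat) i}"
proof (rule finite_subset)
  show "{i. bit n i} \<subseteq> {..<n}"
  proof clarsimp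
    fix i assume "bit n i"
    then have "n div 2 ^ i \<noteq> 0"
      by (metis bit_iff_odd even_zero)
    then have "2 ^ i \<le> n"
      by (metis div_less not_le)
    then show "i < n"
      using less_exp[of i] by (rule order_less_le_trans[rotated])
  qed
qed simp

lemma s2_digits:
  "s2 (\<Sum>i<N. of_bool (e i) * 2 ^ i) = (\<Sum>i<N. of_bool (e i))"
proof -
  have "bit (\<Sum>i<N. of_bool (e i) * 2 ^ i :: nat) j \<longleftrightarrow> j < N \<and> e j" for j
    using bit_horner_sum_bit_iff[where 'a=nat, of "map e [0..<N]" j]
    by (auto simp: horner_sum_eq_sum atLeast0LessThan)
  then show ?thesis
    by (simp add: s2_def sum.If_cases of_bool_def Int_def)
qed

end

(* The vectors (s2 (n + l t) - s2 n) for l = 1..m form an additive monoid, because two pairs (n, t)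
   can be placed in disjoint blocks of digits. For 1 <= c <= m, let 1_c be the indicator of l >= c.
   The pair (2^L - c, 1) gives -L 1_c plus a vector independent of L, since a carry out of the
   L ones occurs exactly when l >= c. The pair (c - 1, 2^K - 1) gives K 1_c plus a vector independent
   of K, since l copies of -1 modulo 2^K make c - 1 negative exactly when l >= c. Adding both, the
   monoid contains a coset g_c + Z 1_c for each c. As the 1_c form a basis of Z^m, the sum of these
   cosets is all of Z^m. *)

theory Submission
  imports Defs
begin

lemma s2_0 [simp]: "s2 0 = 0"
  by (simp add: s2_def)

lemma s2_1 [simp]: "s2 (Suc 0) = 1"
  by (simp add: s2_def bit_Suc_0_iff)

lemma bit_add_shift_iff:
  fixes a b :: nat
  assumes "a < 2 ^ N"
  shows "bit (a + 2 ^ N * b) i \<longleftrightarrow> (if i < N then bit a i else bit b (i - N))"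
proof (cases "i < N")
  case True
  have "take_bit N (a + 2 ^ N * b) = a"
    using assms by (simp add: take_bit_eq_mod)
  then show ?thesis
    using True by (metis bit_take_bit_iff)
next
  case False
  have "drop_bit N (a + 2 ^ N * b) = b"
    using assms by (simp add: drop_bit_eq_div)
  then have "bit (a + 2 ^ N * b) (N + (i - N)) \<longleftrightarrow> bit b (i - N)"
    by (metis bit_drop_bit_eq comp_apply)
  then show ?thesis
    using False by simp
qed

text \<open>The digits of \<open>a\<close> lie below position \<open>N\<close> and those of
  \<open>2 ^ N * b\<close> start there, so the addition produces no carry.\<close>

lemma s2_add_shift:
  assumes "a < 2 ^ N"
  shows "s2 (a + 2 ^ N * b) = s2 a + s2 b"
proof -
  have a: "i < N" if "bit a i" for i
    using that assms by (metis bit_take_bit_iff take_bit_nat_eq_self)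
  have "{i. bit (a + 2 ^ N * b) i} = {i. bit a i} \<union> (\<lambda>i. i + N) ` {i. bit b i}"
    using a by (force simp: bit_add_shift_iff [OF assms] image_iff split: if_splits
        intro: le_add_diff_inverse2 [symmetric])
  moreover have "{i. bit a i} \<inter> (\<lambda>i. i + N) ` {i. bit b i} = {}"
    using a by force
  ultimately show ?thesis
    by (simp add: s2_def card_Un_disjoint finite_bit_nat card_image)
qed

text \<open>Subtracting from \<open>N\<close> ones flips each of the \<open>N\<close> digits. The
  induction splits off the lowest digit.\<close>

lemma s2_complement:
  assumes "a < 2 ^ N"
  shows "int (s2 (2 ^ N - 1 - a)) = int N - int (s2 a)"
  using assms
proof (induction N arbitrary: a)
  case (Suc N)
  have shift1: "s2 (r + 2 * b) = s2 r + s2 b" if "r < 2" for r b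
    using s2_add_shift [of r 1 b] that by simp
  have a: "a = a mod 2 + 2 * (a div 2)" by simp
  have "a div 2 < 2 ^ N" using Suc.prems by auto
  moreover from this have "2 ^ Suc N - 1 - a = (1 - a mod 2) + 2 * (2 ^ N - 1 - a div 2)"
    using Suc.prems by simp presburger
  then have "s2 (2 ^ Suc N - 1 - a) = s2 (1 - a mod 2) + s2 (2 ^ N - 1 - a div 2)"
    using shift1 [of "1 - a mod 2"] by simp
  moreover have "s2 a = s2 (a mod 2) + s2 (a div 2)"
    by (subst a, subst shift1) auto
  moreover have "s2 (1 - a mod 2) + s2 (a mod 2) = 1"
    by (cases "even a") (auto simp: even_iff_mod_2_eq_zero odd_iff_mod_2_eq_one)
  ultimately show ?case
    using Suc.IH [of "a div 2"] by linarith
qed simp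

definition attained :: "nat \<Rightarrow> (nat \<Rightarrow> int) \<Rightarrow> bool" where
  "attained m f \<longleftrightarrow> (\<exists>n t. \<forall>l\<in>{1..m}. f l = int (s2 (n + l * t)) - int (s2 n))"

lemma attainedI:
  assumes "\<And>l. 1 \<le> l \<Longrightarrow> l \<le> m \<Longrightarrow> f l = int (s2 (n + l * t)) - int (s2 n)"
  shows "attained m f"
  using assms unfolding attained_def by (meson atLeastAtMost_iff)

lemma attained_0: "attained m (\<lambda>l. 0)"
  by (rule attainedI [where t = 0]) simp

lemma attained_add:
  assumes "attained m f" "attained m g"
  shows "attained m (\<lambda>l. f l + g l)"
proof -
  obtain n t where f: "\<forall>l\<in>{1..m}. f l = int (s2 (n + l * t)) - int (s2 n)"
    using assms(1) by (auto simp: attained_def)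
  obtain n' t' where g: "\<forall>l\<in>{1..m}. g l = int (s2 (n' + l * t')) - int (s2 n')"
    using assms(2) by (auto simp: attained_def)
  \<comment> \<open>A crude block width: since \<open>N < 2 ^ N\<close>, every
    \<open>n + l * t\<close> with \<open>l \<le> m\<close> stays inside the lower block, including
    \<open>n\<close> itself.\<close>
  define N where "N = n + m * t"
  have small: "n + l * t < 2 ^ N" if "l \<le> m" for l
  proof -
    have "n + l * t \<le> N" using that by (simp add: N_def)
    also have "N < 2 ^ N" by (rule less_exp)
    finally show ?thesis .
  qed
  show ?thesis
  proof (rule attainedI)
    fix l assume l: "1 \<le> l" "l \<le> m"
    have "(n + 2 ^ N * n') + l * (t + 2 ^ N * t') = (n + l * t) + 2 ^ N * (n' + l * t')"
      by (simp add: algebra_simps)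
    then have "s2 ((n + 2 ^ N * n') + l * (t + 2 ^ N * t')) = s2 (n + l * t) + s2 (n' + l * t')"
      using s2_add_shift [OF small [of l]] l by metis
    then show "f l + g l = int (s2 ((n + 2 ^ N * n') + l * (t + 2 ^ N * t'))) - int (s2 (n + 2 ^ N * n'))"
      using f g l small [of 0] by (simp add: s2_add_shift)
  qed
qed

lemma attained_sum:
  assumes "finite C" "\<And>c. c \<in> C \<Longrightarrow> attained m (f c)"
  shows "attained m (\<lambda>l. \<Sum>c\<in>C. f c l)"
  using assms by (induction C rule: finite_induct) (simp_all add: attained_0 attained_add)

lemma attained_decreasing:
  assumes "1 \<le> c" "c \<le> m" "m \<le> L"
  shows "attained m (\<lambda>l. if l < c then int (s2 (c - 1)) - int (s2 (c - 1 - l))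
    else int (s2 (l - c)) + 1 + int (s2 (c - 1)) - int L)"
proof (rule attainedI [where n = "2 ^ L - c" and t = 1])
  fix l assume l: "1 \<le> l" "l \<le> m"
  have L: "m < 2 ^ L"
    using assms less_exp [of L] by linarith
  have n: "int (s2 (2 ^ L - c)) = int L - int (s2 (c - 1))"
    using s2_complement [of "c - 1" L] assms L by simp
  show "(if l < c then int (s2 (c - 1)) - int (s2 (c - 1 - l))
    else int (s2 (l - c)) + 1 + int (s2 (c - 1)) - int L)
    = int (s2 (2 ^ L - c + l * 1)) - int (s2 (2 ^ L - c))"
  \<comment> \<open>Below \<open>c\<close> the sum is still the complement of
    \<open>c - 1 - l\<close> in \<open>L\<close> digits. From \<open>c\<close> on it has overflowed
    to a single one at position \<open>L\<close> above the digits of \<open>l - c\<close>.\<close>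
  proof (cases "l < c")
    case True
    then have "2 ^ L - c + l * 1 = 2 ^ L - 1 - (c - 1 - l)"
      using assms L by simp
    then show ?thesis
      using True n s2_complement [of "c - 1 - l" L] assms L by simp
  next
    case False
    then have "2 ^ L - c + l * 1 = (l - c) + 2 ^ L * 1"
      using assms L by simp
    then show ?thesis
      using False n s2_add_shift [of "l - c" L 1] l L by simp
  qed
qed

lemma attained_increasing:
  assumes "1 \<le> c" "c \<le> m" "m \<le> K"
  shows "attained m (\<lambda>l. if l < c then int (s2 l) + int (s2 (c - 1 - l)) - int (s2 (c - 1))
    else int (s2 (l - 1)) - int (s2 (l - c)) - int (s2 (c - 1)) + int K)"
proof (rule attainedI [where n = "c - 1" and t = "2 ^ K - 1"])
  fix l assume l: "1 \<le> l" "l \<le> m"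
  have K: "m < 2 ^ K"
    using assms less_exp [of K] by linarith
  have le: "l \<le> l * 2 ^ K" "2 ^ K \<le> l * 2 ^ K"
    using l by simp_all
  show "(if l < c then int (s2 l) + int (s2 (c - 1 - l)) - int (s2 (c - 1))
    else int (s2 (l - 1)) - int (s2 (l - c)) - int (s2 (c - 1)) + int K)
    = int (s2 (c - 1 + l * (2 ^ K - 1))) - int (s2 (c - 1))"
  \<comment> \<open>The sum is \<open>2 ^ K * l + (c - 1 - l)\<close> over the integers. Once
    \<open>l\<close> reaches \<open>c\<close>, the low block must borrow: the high block drops to
    \<open>l - 1\<close> and the low one becomes the complement of \<open>l - c\<close>.\<close>
  proof (cases "l < c")
    case True
    then have "c - 1 + l * (2 ^ K - 1) = (c - 1 - l) + 2 ^ K * l"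
      using le by (simp add: diff_mult_distrib2 mult.commute)
    then show ?thesis
      using True s2_add_shift [of "c - 1 - l" K l] assms K by simp
  next
    case False
    then have "c - 1 + l * (2 ^ K - 1) = (2 ^ K - 1 - (l - c)) + 2 ^ K * (l - 1)"
      using le assms l K by (cases l) (simp_all add: diff_mult_distrib2 mult.commute)
    then show ?thesis
      using False s2_add_shift [of "2 ^ K - 1 - (l - c)" K "l - 1"] s2_complement [of "l - c" K] l K
      by simp
  qed
qed

text \<open>Adding the two families cancels every digit sum that involves \<open>c\<close>. What
  remains is a fixed vector plus a free multiple \<open>z\<close> of the indicator of
  \<open>c \<le> l\<close>.\<close>

lemma attained_step:
  assumes "1 \<le> c" "c \<le> m"
  shows "attained m (\<lambda>l. (if l < c then int (s2 l) else int (s2 (l - 1)) + 1) + (if c \<le> l then z else 0))"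
    (is "attained m ?f")
proof -
  \<comment> \<open>Both lengths are at least \<open>m\<close>, and \<open>?K - ?L\<close> equals
    \<open>z\<close> for either sign of \<open>z\<close>.\<close>
  let ?L = "m + nat (- z)" and ?K = "m + nat z"
  have "?f = (\<lambda>l. (if l < c then int (s2 (c - 1)) - int (s2 (c - 1 - l))
      else int (s2 (l - c)) + 1 + int (s2 (c - 1)) - int ?L) +
    (if l < c then int (s2 l) + int (s2 (c - 1 - l)) - int (s2 (c - 1))
      else int (s2 (l - 1)) - int (s2 (l - c)) - int (s2 (c - 1)) + int ?K))"
    by (rule ext) auto
  then show ?thesis
    using attained_add [OF attained_decreasing [of c m ?L] attained_increasing [of c m ?K]] assms
    by simp
qed

theorem theorem1:
  fixes m :: nat and k :: "nat \<Rightarrow> int"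
  assumes "m \<ge> 1"
  shows "\<exists>n t :: nat. \<forall>l. 1 \<le> l \<and> l \<le> m \<longrightarrow> k l = int (s2 (n + l * t)) - int (s2 n)"
proof -
  define g where "g c l = (if l < c then int (s2 l) else int (s2 (l - 1)) + 1)" for c l
  \<comment> \<open>\<open>d\<close> is what the indicators must supply beyond the fixed vectors
    \<open>g c\<close>. Its coefficient at the indicator of \<open>c \<le> l\<close> is
    \<open>d c - d (c - 1)\<close>, and the value 0 at 0 makes the telescoping sum equal
    \<open>d l\<close>.\<close>
  define d where "d l = (if l = 0 then 0 else k l - (\<Sum>c=1..m. g c l))" for l
  have "attained m (\<lambda>l. \<Sum>c=1..m. g c l + (if c \<le> l then d c - d (c - 1) else 0))"
    unfolding g_def by (intro attained_sum attained_step) auto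
  moreover have "(\<Sum>c=1..m. g c l + (if c \<le> l then d c - d (c - 1) else 0)) = k l"
    if "l \<in> {1..m}" for l
  proof -
    have "(\<Sum>c=1..m. if c \<le> l then d c - d (c - 1) else 0) = (\<Sum>c=1..l. d c - d (c - 1))"
      using that by (intro sum.mono_neutral_cong_right) auto
    also have "\<dots> = d l"
      using sum_telescope'' [of 0 l d] by (simp add: d_def)
    finally show ?thesis
      using that by (simp add: sum.distrib d_def)
  qed
  ultimately have "attained m k"
    by (simp add: attained_def)
  then show ?thesis
    unfolding attained_def by (meson atLeastAtMost_iff)
qed

end
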